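(* Let $n$ be a positive integer, let $\mathbb{F}$ be a field, and let $\mathcal{V}\subseteq\mathbb{F}^n$ be a finite subset of the affine space $\mathbb{F}^n$. Suppose that there exists a finite subgroup $G\leq\mathrm{Aff}(\mathbb{F},n)$ such that $G$ is a transitive subgroup of the symmetric group $\mathrm{Sym}(\mathcal{V})$. Define $v:=|\mathcal{V}|$. Let $k\geq 0$ be any non-negative integer such that $$\binom{n+k}{n}<v.$$ Then $$k<ac(\mathcal{V}).$$
   Context: $\mathrm{Aff}(\mathbb{F},n)$ is the group of affine isomorphisms of $\mathbb{F}^n$, and $\mathrm{Sym}(\mathcal{V})$ is the group of all permutations of $\mathcal{V}$. That $G$ is a transitive subgroup of $\mathrm{Sym}(\mathcal{V})$ means that every $g\in G$ maps $\mathcal{V}$ onto itself and that $G$, regarded via restriction to $\mathcal{V}$ as a group of permutations of $\mathcal{V}$, acts transitively on $\mathcal{V}$. For a finite set of points $\mathcal{V}\subseteq\mathbb{F}^n$ and $\mathbf{v}\in\mathcal{V}$, a finite set of affine hyperplanes $\{H_1,\ldots,H_m\}$ of $\mathbb{F}^n$ is an almost cover of $\mathcal{V}$ and $\mathbf{v}$ if the union $\bigcup_{j=1}^m H_j$ contains $\mathcal{V}\setminus\{\mathbf{v}\}$ but does not contain $\mathbf{v}$. $AC(\mathcal{V},\mathbf{v})$ denotes the minimum size (number of hyperplanes) of an almost cover of $\mathcal{V}$ and $\mathbf{v}$, and $ac(\mathcal{V}):=\min_{\mathbf{v}\in\mathcal{V}}AC(\mathcal{V},\mathbf{v})$. *)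

theory Defs
  imports "HOL-Analysis.Cartesian_Space" "HOL-Algebra.Group"
begin

definition affine_isos :: "('a::field ^ 'n \<Rightarrow> 'a ^ 'n) set"
  where "affine_isos =
    {f. \<exists>L b. Vector_Spaces.linear (*s) (*s) L \<and> bij L \<and> f = (\<lambda>x. L x + b)}"

definition Aff :: "('a::field ^ 'n \<Rightarrow> 'a ^ 'n) monoid"
  where "Aff = \<lparr>carrier = affine_isos, mult = (\<circ>), one = id\<rparr>"

lemma group_Aff: "group (Aff :: ('a::field ^ 'n \<Rightarrow> 'a ^ 'n) monoid)"
proof (rule groupI)
  fix f g :: "'a ^ 'n \<Rightarrow> 'a ^ 'n"
  assume "f \<in> carrier Aff" "g \<in> carrier Aff"
  then obtain L b M c
    where L: "Vector_Spaces.linear (*s) (*s) L" "bij L" "f = (\<lambda>x. L x + b)"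
      and M: "Vector_Spaces.linear (*s) (*s) M" "bij M" "g = (\<lambda>x. M x + c)"
    unfolding Aff_def affine_isos_def by auto
  have "f \<circ> g = (\<lambda>x. (L \<circ> M) x + (L c + b))"
    using L(3) M(3) by (simp add: fun_eq_iff vec.linear_add[OF L(1)] add.assoc)
  moreover have "Vector_Spaces.linear (*s) (*s) (L \<circ> M)"
    using L(1) M(1) by (rule Vector_Spaces.linear_compose[rotated])
  moreover have "bij (L \<circ> M)"
    using L(2) M(2) by (rule bij_comp[rotated])
  ultimately have "f \<circ> g \<in> affine_isos"
    unfolding affine_isos_def by blast
  then show "f \<otimes>\<^bsub>Aff\<^esub> g \<in> carrier Aff"
    by (simp add: Aff_def)
next
  show "\<one>\<^bsub>Aff\<^esub> \<in> carrier (Aff :: ('a ^ 'n \<Rightarrow> 'a ^ 'n) monoid)"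
    unfolding Aff_def affine_isos_def
    by (auto intro!: exI[of _ id] exI[of _ 0] simp: vec.linear_id fun_eq_iff)
next
  fix f :: "'a ^ 'n \<Rightarrow> 'a ^ 'n"
  assume "f \<in> carrier Aff"
  then obtain L b
    where L: "Vector_Spaces.linear (*s) (*s) L" "bij L" "f = (\<lambda>x. L x + b)"
    unfolding Aff_def affine_isos_def by auto
  obtain M where M: "Vector_Spaces.linear (*s) (*s) M" "M \<circ> L = id"
    using vec.linear_injective_left_inverse[OF L(1) bij_is_inj[OF L(2)]] by blast
  have left_inv: "M (L x) = x" for x
    using M(2) by (simp add: fun_eq_iff)
  have "bij M"
    using M(2) L(2) by (metis bij_betw_comp_iff bij_id)
  then have "(\<lambda>x. M x + - M b) \<in> affine_isos"
    using M(1) unfolding affine_isos_def by blast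
  then have "(\<lambda>x. M x + - M b) \<in> carrier Aff"
    by (simp add: Aff_def)
  moreover have "(\<lambda>x. M x + - M b) \<otimes>\<^bsub>Aff\<^esub> f = \<one>\<^bsub>Aff\<^esub>"
    using L(3) by (simp add: Aff_def fun_eq_iff vec.linear_add[OF M(1)] left_inv)
  ultimately show "\<exists>g\<in>carrier Aff. g \<otimes>\<^bsub>Aff\<^esub> f = \<one>\<^bsub>Aff\<^esub>" by blast
qed (auto simp: Aff_def comp_assoc)

text \<open>The elements of \<open>G\<close> are maps of the whole space; they permute \<open>V\<close> by restriction,
  and distinct elements may have the same restriction.\<close>

definition transitive_on :: "('b \<Rightarrow> 'b) set \<Rightarrow> 'b set \<Rightarrow> bool"
  where "transitive_on G V \<longleftrightarrow>
    (\<forall>g\<in>G. bij_betw g V V) \<and> (\<forall>x\<in>V. \<forall>y\<in>V. \<exists>g\<in>G. g x = y)"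

definition affine_hyperplane :: "('a::field ^ 'n) set \<Rightarrow> bool"
  where "affine_hyperplane H \<longleftrightarrow>
    (\<exists>a c. a \<noteq> 0 \<and> H = {x. (\<Sum>i\<in>UNIV. a $ i * x $ i) = c})"

definition almost_cover :: "('a::field ^ 'n) set set \<Rightarrow> ('a ^ 'n) set \<Rightarrow> 'a ^ 'n \<Rightarrow> bool"
  where "almost_cover \<H> V v \<longleftrightarrow>
    finite \<H> \<and> (\<forall>H\<in>\<H>. affine_hyperplane H) \<and> V - {v} \<subseteq> \<Union>\<H> \<and> v \<notin> \<Union>\<H>"

definition AC :: "('a::field ^ 'n) set \<Rightarrow> 'a ^ 'n \<Rightarrow> nat"
  where "AC V v = (LEAST m. \<exists>\<H>. almost_cover \<H> V v \<and> card \<H> = m)"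

definition ac :: "('a::field ^ 'n) set \<Rightarrow> nat"
  where "ac V = Min (AC V ` V)"

text \<open>For finite \<open>V\<close> the minimum defining \<open>AC V v\<close> is over a nonempty set.\<close>

lemma almost_cover_exists:
  fixes V :: "('a::field ^ 'n) set"
  assumes "finite V"
  shows "\<exists>\<H>. almost_cover \<H> V v"
proof -
  have "\<exists>H. affine_hyperplane H \<and> w \<in> H \<and> v \<notin> H" if neq: "w \<noteq> v" for w
  proof -
    obtain j where j: "w $ j \<noteq> v $ j"
      using neq by (auto simp: vec_eq_iff)
    have eq: "(\<Sum>i\<in>UNIV. axis j 1 $ i * x $ i) = x $ j" for x :: "'a ^ 'n"
      by (simp add: axis_def if_distrib[where f = "\<lambda>t. t * _"] cong: if_cong)
    have "axis j (1::'a) \<noteq> 0"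
      by (simp add: axis_eq_0_iff)
    then have "affine_hyperplane {x. (\<Sum>i\<in>UNIV. axis j 1 $ i * x $ i) = w $ j}"
      unfolding affine_hyperplane_def by blast
    with j show ?thesis
      unfolding eq by (intro exI[of _ "{x. x $ j = w $ j}"]) auto
  qed
  then obtain h where h: "\<And>w. w \<noteq> v \<Longrightarrow> affine_hyperplane (h w) \<and> w \<in> h w \<and> v \<notin> h w"
    by metis
  have "almost_cover (h ` (V - {v})) V v"
    using assms h unfolding almost_cover_def by auto
  then show ?thesis by blast
qed

end

theory Submission
  imports Defs "HOL-Library.Function_Algebras" "HOL-Library.Multiset"
begin

text \<open>The linear forms of an almost cover of \<open>V\<close> and \<open>v\<close> by at most \<open>k\<close> hyperplanes multiply
  to a polynomial of degree at most \<open>k\<close> whose only non-root in \<open>V\<close> is \<open>v\<close>. Composing it with the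
  elements of \<open>G\<close>, which preserves the degree, yields such a polynomial for every point of \<open>V\<close>.
  These \<open>card V\<close> polynomials are linearly independent, so \<open>card V\<close> is at most the number
  \<open>(n + k) choose n\<close> of monomials of degree at most \<open>k\<close>.\<close>

text \<open>Makes span, independence and the exchange bound available for functions with values in a
  field.\<close>

interpretation fun_space: vector_space "\<lambda>c (f :: 'b \<Rightarrow> 'a::field) x. c * f x"
  by unfold_locales (simp_all add: fun_eq_iff algebra_simps)

lemma sum_fun_apply: "sum f A x = (\<Sum>a\<in>A. f a x)"
  for f :: "'c \<Rightarrow> 'b \<Rightarrow> 'a::comm_monoid_add"
  by (induction A rule: infinite_finite_induct) simp_all

text \<open>Evaluating a vanishing linear combination at \<open>w\<close> leaves only the term of
  \<open>F w\<close>, so its coefficient is zero. Hence the \<open>F w\<close> are independent, and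
  no spanning set can be smaller.\<close>

lemma card_le_if_separated:
  fixes F :: "'b \<Rightarrow> 'b \<Rightarrow> 'a::field"
  assumes "finite V" "finite T"
    and span: "\<And>w. w \<in> V \<Longrightarrow> F w \<in> fun_space.span T"
    and nz: "\<And>w. w \<in> V \<Longrightarrow> F w w \<noteq> 0"
    and zero: "\<And>w u. w \<in> V \<Longrightarrow> u \<in> V \<Longrightarrow> u \<noteq> w \<Longrightarrow> F w u = 0"
  shows "card V \<le> card T"
proof -
  have inj: "inj_on F V"
    using nz zero by (metis inj_onI)
  have "fun_space.independent (F ` V)"
  proof (subst fun_space.independent_explicit_finite_subsets, intro allI impI ballI)
    fix S c f
    assume S: "S \<subseteq> F ` V" "finite S" and sum: "(\<Sum>f\<in>S. (\<lambda>x. c f * f x)) = 0" and f: "f \<in> S"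
    obtain w where w: "w \<in> V" "f = F w"
      using S f by auto
    have "0 = (\<Sum>h\<in>S. c h * h w)"
      using fun_cong[OF sum, of w] by (simp add: sum_fun_apply)
    also have "\<dots> = (\<Sum>h\<in>{f}. c h * h w)"
      using S f w zero by (intro sum.mono_neutral_right) auto
    finally show "c f = 0"
      using w nz by simp
  qed
  moreover have "F ` V \<subseteq> fun_space.span T"
    using span by auto
  ultimately have "card (F ` V) \<le> card T"
    using fun_space.independent_span_bound \<open>finite T\<close> by blast
  then show ?thesis
    by (simp add: card_image[OF inj])
qed

text \<open>Homogeneous coordinates: with the extra coordinate \<open>None\<close> set to \<open>1\<close>, the monomials of
  degree at most \<open>k\<close> in \<open>n\<close> variables are those of degree exactly \<open>k\<close> in \<open>n + 1\<close> variables.\<close>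

definition hcoord :: "'n option \<Rightarrow> 'a::field ^ 'n \<Rightarrow> 'a"
  where "hcoord i x = (case i of None \<Rightarrow> 1 | Some j \<Rightarrow> x $ j)"

definition hmonom :: "'n option multiset \<Rightarrow> 'a::field ^ 'n \<Rightarrow> 'a"
  where "hmonom M x = (\<Prod>i\<in>#M. hcoord i x)"

definition affine_forms :: "('a::field ^ 'n \<Rightarrow> 'a) set"
  where "affine_forms = fun_space.span (range hcoord)"

definition poly_funs :: "nat \<Rightarrow> ('a::field ^ 'n \<Rightarrow> 'a) set"
  where "poly_funs k = fun_space.span (hmonom ` multisets_of_size UNIV k)"

lemma one_in_affine_forms: "(\<lambda>x. 1) \<in> affine_forms"
proof -
  have "(\<lambda>x. 1) = hcoord None"
    by (simp add: hcoord_def fun_eq_iff)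
  then show ?thesis
    unfolding affine_forms_def by (metis fun_space.span_base rangeI)
qed

lemma affine_formsI: "(\<lambda>x. (\<Sum>i\<in>UNIV. a $ i * x $ i) + b) \<in> affine_forms"
proof -
  have eq: "(\<lambda>x. (\<Sum>i\<in>UNIV. a $ i * x $ i) + b) =
      (\<Sum>i\<in>UNIV. (\<lambda>x. a $ i * hcoord (Some i) x)) + (\<lambda>x. b * hcoord None x)"
    by (simp add: fun_eq_iff sum_fun_apply hcoord_def)
  show ?thesis
    unfolding eq affine_forms_def
    by (intro fun_space.span_add fun_space.span_sum fun_space.span_scale fun_space.span_base rangeI)
qed

text \<open>By linearity it suffices to treat one coordinate. The constant one is unchanged;
  coordinate \<open>j\<close> of \<open>g\<close> has row \<open>j\<close> of the matrix of
  \<open>L\<close> as coefficients and \<open>b $ j\<close> as constant term.\<close>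

lemma affine_forms_comp:
  assumes "f \<in> affine_forms" and "g \<in> affine_isos"
  shows "f \<circ> g \<in> affine_forms"
  using assms(1)[unfolded affine_forms_def]
proof (induction rule: fun_space.span_induct_alt)
  case base
  have "0 \<circ> g = 0"
    by (simp add: fun_eq_iff)
  then show ?case
    unfolding affine_forms_def by (metis fun_space.span_zero)
next
  case (step c h f)
  obtain L b where L: "Vector_Spaces.linear (*s) (*s) L" and g: "g = (\<lambda>x. L x + b)"
    using assms(2) unfolding affine_isos_def by auto
  obtain i where i: "h = hcoord i"
    using step by auto
  have h: "h \<circ> g \<in> affine_forms"
  proof (cases i)
    case None
    then have "h \<circ> g = (\<lambda>x. 1)"
      by (simp add: i hcoord_def fun_eq_iff)
    then show ?thesis
      by (simp add: one_in_affine_forms)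
  next
    case (Some j)
    have "L x $ j = (\<Sum>i\<in>UNIV. matrix L $ j $ i * x $ i)" for x
      using matrix_works[OF L, of x] by (simp add: matrix_vector_mult_def vec_eq_iff)
    then have "h \<circ> g = (\<lambda>x. (\<Sum>i\<in>UNIV. matrix L $ j $ i * x $ i) + b $ j)"
      by (simp add: i g Some hcoord_def fun_eq_iff)
    then show ?thesis
      by (simp add: affine_formsI)
  qed
  have eq: "((\<lambda>x. c * h x) + f) \<circ> g = (\<lambda>x. c * (h \<circ> g) x) + (f \<circ> g)"
    by (simp add: fun_eq_iff)
  show ?case
    using h step.IH unfolding eq affine_forms_def
    by (intro fun_space.span_add fun_space.span_scale)
qed

text \<open>Multiplying a monomial by a coordinate adds one element to its multiset, so the size
  grows by exactly one even for the constant coordinate \<open>None\<close>. Bilinearity extends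
  this first to all \<open>f\<close>, then to all \<open>l\<close>.\<close>

lemma poly_funs_mult:
  assumes l: "l \<in> affine_forms" and f: "f \<in> poly_funs k"
  shows "l * f \<in> poly_funs (Suc k)"
proof -
  have monom: "hcoord i * hmonom M \<in> poly_funs (Suc k)" if "M \<in> multisets_of_size UNIV k" for i M
  proof -
    have "hcoord i * hmonom M = hmonom (add_mset i M)"
      by (simp add: hmonom_def fun_eq_iff)
    with that show ?thesis
      unfolding poly_funs_def by (auto intro!: fun_space.span_base simp: multisets_of_size_def)
  qed
  have coord: "hcoord i * f \<in> poly_funs (Suc k)" for i
    using f[unfolded poly_funs_def]
  proof (induction rule: fun_space.span_induct_alt)
    case base
    have "hcoord i * 0 = 0"
      by (simp add: fun_eq_iff)
    then show ?case
      unfolding poly_funs_def by (metis fun_space.span_zero)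
  next
    case (step c h f)
    have eq: "hcoord i * ((\<lambda>x. c * h x) + f) = (\<lambda>x. c * (hcoord i * h) x) + hcoord i * f"
      by (simp add: fun_eq_iff algebra_simps)
    have "hcoord i * h \<in> poly_funs (Suc k)"
      using step.hyps monom by blast
    then show ?case
      using step.IH unfolding eq poly_funs_def
      by (intro fun_space.span_add fun_space.span_scale)
  qed
  show ?thesis
    using l[unfolded affine_forms_def]
  proof (induction rule: fun_space.span_induct_alt)
    case base
    have "0 * f = 0"
      by (simp add: fun_eq_iff)
    then show ?case
      unfolding poly_funs_def by (metis fun_space.span_zero)
  next
    case (step c h l)
    have eq: "((\<lambda>x. c * h x) + l) * f = (\<lambda>x. c * (h * f) x) + l * f"
      by (simp add: fun_eq_iff algebra_simps)
    have "h * f \<in> poly_funs (Suc k)"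
      using step.hyps coord by blast
    then show ?case
      using step.IH unfolding eq poly_funs_def
      by (intro fun_space.span_add fun_space.span_scale)
  qed
qed

lemma prod_affine_forms_in_poly_funs:
  assumes "finite A" and "\<And>a. a \<in> A \<Longrightarrow> l a \<in> affine_forms"
  shows "(\<lambda>x. \<Prod>a\<in>A. l a x) \<in> poly_funs (card A)"
  using assms
proof (induction A rule: finite_induct)
  case empty
  have "(\<lambda>x. 1) = hmonom {#}"
    by (simp add: hmonom_def fun_eq_iff)
  then show ?case
    by (auto simp: poly_funs_def intro: fun_space.span_base)
next
  case (insert a A)
  have "(\<lambda>x. \<Prod>a\<in>insert a A. l a x) = l a * (\<lambda>x. \<Prod>a\<in>A. l a x)"
    using insert.hyps by (simp add: fun_eq_iff)
  with insert show ?case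
    by (simp add: poly_funs_mult)
qed

lemma affine_hyperplane_form:
  assumes "affine_hyperplane H"
  shows "\<exists>l\<in>affine_forms. H = {x. l x = 0}"
proof -
  obtain a c where H: "H = {x. (\<Sum>i\<in>UNIV. a $ i * x $ i) = c}"
    using assms unfolding affine_hyperplane_def by blast
  show ?thesis
    by (rule bexI[OF _ affine_formsI[of a "- c"]]) (simp add: H)
qed

lemma card_le_choose_if_almost_cover:
  fixes V :: "('a::field ^ 'n) set"
  assumes "finite V" and "v \<in> V" and G: "G \<subseteq> affine_isos" "transitive_on G V"
    and cover: "almost_cover \<H> V v"
  shows "card V \<le> (CARD('n) + card \<H>) choose CARD('n)"
proof -
  have \<H>: "finite \<H>" "V - {v} \<subseteq> \<Union>\<H>" "v \<notin> \<Union>\<H>"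
    and "\<forall>H\<in>\<H>. \<exists>l\<in>affine_forms. H = {x. l x = 0}"
    using cover affine_hyperplane_form unfolding almost_cover_def by auto
  then obtain l where l: "\<And>H. H \<in> \<H> \<Longrightarrow> l H \<in> affine_forms"
      "\<And>H x. H \<in> \<H> \<Longrightarrow> x \<in> H \<longleftrightarrow> l H x = 0"
    by (metis (mono_tags, lifting) mem_Collect_eq)
  have "\<forall>w\<in>V. \<exists>g\<in>G. g w = v"
    using G \<open>v \<in> V\<close> unfolding transitive_on_def by blast
  then obtain g where g: "\<And>w. w \<in> V \<Longrightarrow> g w \<in> G" "\<And>w. w \<in> V \<Longrightarrow> g w w = v"
    by metis
  \<comment> \<open>\<open>g w\<close> is injective on \<open>V\<close> and already takes the value
    \<open>v\<close> at \<open>w\<close>.\<close>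
  have moved: "g w u \<in> V - {v}" if "w \<in> V" "u \<in> V" "u \<noteq> w" for w u
    using that g G unfolding transitive_on_def by (metis DiffI bij_betw_def imageI inj_onD singletonD)
  let ?T = "hmonom ` multisets_of_size UNIV (card \<H>) :: ('a ^ 'n \<Rightarrow> 'a) set"
  have "card V \<le> card ?T"
  \<comment> \<open>The product of the forms, pulled back along \<open>g w\<close>: at
    \<open>w\<close> it is evaluated at \<open>v\<close>, which no hyperplane contains; at any other
    point of \<open>V\<close> it is evaluated at a covered point.\<close>
  proof (rule card_le_if_separated[where F = "\<lambda>w x. \<Prod>H\<in>\<H>. (l H \<circ> g w) x"])
    show "(\<lambda>x. \<Prod>H\<in>\<H>. (l H \<circ> g w) x) \<in> fun_space.span ?T" if "w \<in> V" for w
      using prod_affine_forms_in_poly_funs[OF \<H>(1), of "\<lambda>H. l H \<circ> g w"] that g(1) G(1) l(1)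
      by (auto simp: poly_funs_def intro: affine_forms_comp)
    show "(\<Prod>H\<in>\<H>. (l H \<circ> g w) w) \<noteq> 0" if "w \<in> V" for w
      using \<H> l(2) g(2)[OF that] by auto
    show "(\<Prod>H\<in>\<H>. (l H \<circ> g w) u) = 0"
      if uw: "w \<in> V" "u \<in> V" "u \<noteq> w" for w u
    proof -
      obtain H where "H \<in> \<H>" "g w u \<in> H"
        using moved[OF uw] \<H>(2) by blast
      with \<H>(1) l(2) show ?thesis
        by (auto intro!: prod_zero)
    qed
  qed (simp_all add: \<open>finite V\<close> finite_multisets_of_size)
  \<comment> \<open>Only an inequality: over a finite field, different monomials may define the same
    function.\<close>
  also have "card ?T \<le> card (multisets_of_size (UNIV :: 'n option set) (card \<H>))"
    by (intro card_image_le finite_multisets_of_size) simp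
  \<comment> \<open>Stars and bars with \<open>CARD('n) + 1\<close> symbols, the extra one being
    \<open>None\<close>.\<close>
  also have "\<dots> = (CARD('n) + card \<H>) choose card \<H>"
    by (subst card_multisets_of_size) simp_all
  also have "\<dots> = (CARD('n) + card \<H>) choose CARD('n)"
    by (subst binomial_symmetric) simp_all
  finally show ?thesis .
qed

theorem corollary1p10:
  fixes V :: "('a::field ^ 'n) set" and k :: nat
  assumes "finite V"
    and "\<exists>G. subgroup G (Aff :: ('a ^ 'n \<Rightarrow> 'a ^ 'n) monoid) \<and> finite G \<and> transitive_on G V"
    and "(CARD('n) + k) choose CARD('n) < card V"
  shows "k < ac V"
proof -
  obtain G where "subgroup G (Aff :: ('a ^ 'n \<Rightarrow> 'a ^ 'n) monoid)" and trans: "transitive_on G V"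
    using assms(2) by blast
  then have G: "G \<subseteq> affine_isos"
    using subgroup.subset by (fastforce simp: Aff_def)
  have "k < AC V v" if "v \<in> V" for v
  proof (rule ccontr)
    assume "\<not> k < AC V v"
    moreover have "\<exists>m \<H>. almost_cover \<H> V v \<and> card \<H> = m"
      using almost_cover_exists[OF assms(1)] by blast
    then have "\<exists>\<H>. almost_cover \<H> V v \<and> card \<H> = AC V v"
      unfolding AC_def by (rule LeastI_ex)
    \<comment> \<open>The minimum \<open>AC V v\<close> is attained, so some almost cover has at
      most \<open>k\<close> members.\<close>
    ultimately obtain \<H> where \<H>: "almost_cover \<H> V v" "card \<H> \<le> k"
      by auto
    have "card V \<le> (CARD('n) + card \<H>) choose CARD('n)"
      using assms(1) that G trans \<H>(1) by (rule card_le_choose_if_almost_cover)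
    also have "\<dots> \<le> (CARD('n) + k) choose CARD('n)"
      using \<H>(2) by (intro binomial_right_mono) simp
    finally show False
      using assms(3) by simp
  qed
  \<comment> \<open>Ensures that \<open>Min\<close> in \<open>ac V\<close> ranges over a nonempty
    set, so that it is one of the values \<open>AC V v\<close>.\<close>
  moreover have "V \<noteq> {}"
    using assms(3) by auto
  ultimately show ?thesis
    using assms(1) by (simp add: ac_def)
qed

end
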